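(* Let $\alpha: I\to E^3$ be a Frenet curve with Frenet frame $\{T,N,B\}$, curvature $\kappa$ and torsion $\tau$, and let $\beta$ be an $X$-direction curve of $\alpha$, where $X=aT+bN+cB$ with $a,b,c$ smooth functions of $s$ satisfying $a^2+b^2+c^2=1$. Then $\beta$ is an evolute-direction curve of $\alpha$ if and only if $$a(s)=0,\qquad b(s)=\sin\left(\int\tau\,ds\right),\qquad c(s)=\cos\left(\int\tau\,ds\right).$$
   Context: $I\subset\mathbb{R}$ is an open interval and $E^3$ is Euclidean 3-space. A unit speed curve $\alpha:I\to E^3$ is a Frenet curve if its curvature $\kappa=\|\alpha''\|$ is nowhere zero; then $T=\alpha'$, $\alpha''=\kappa N$, $B=T\times N$, and $T'=\kappa N$, $N'=-\kappa T+\tau B$, $B'=-\tau N$, where $\tau$ is the torsion. For a unit vector valued function $X(s)=a(s)T(s)+b(s)N(s)+c(s)B(s)$ with $a,b,c$ smooth and $a^2+b^2+c^2=1$, an $X$-direction curve of $\alpha$ is a curve $\beta:I\to E^3$ that is an integral curve of $X$, i.e. $\beta'(s)=X(s)$; the arc length parameter $s$ of $\alpha$ is then also an arc length parameter of $\beta$. The Frenet vectors and curvatures of $\beta$ are denoted $\{\overline T,\overline N,\overline B\}$, $\overline\kappa,\overline\tau$. An $X$-direction curve $\beta$ of $\alpha$ is called an evolute-direction curve of $\alpha$ if $\beta$ is an evolute of $\alpha$; the evolute relation is used in the form $\langle\overline T,T\rangle=0$ and $\overline N=T$ at corresponding parameter values. $\int\tau\,ds$ denotes an indefinite integral of $\tau$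 with respect to $s$.
   Formalization: β is assumed to be a Frenet curve (otherwise τ=0, b=0, c=1 gives a straight line), and the principal normal of β may be taken with either orientation (signed nonzero curvature), since N̄=T with positive curvature would force b<0. *)

theory Defs
  imports "HOL-Analysis.Analysis"
begin

unbundle cross3_syntax

definition vd :: "(real \<Rightarrow> 'a::real_normed_vector) \<Rightarrow> real \<Rightarrow> 'a" where
  "vd f = (\<lambda>s. vector_derivative f (at s))"

(* Only meant for open I: the two-sided derivatives at points of I then depend on f on I only. *)
definition smooth_on :: "real set \<Rightarrow> (real \<Rightarrow> 'a::real_normed_vector) \<Rightarrow> bool" where
  "smooth_on I f \<longleftrightarrow> (\<forall>n. \<forall>s\<in>I. (vd ^^ n) f differentiable (at s))"

definition tangent :: "(real \<Rightarrow> real^3) \<Rightarrow> real \<Rightarrow> real^3" where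
  "tangent \<gamma> = vd \<gamma>"

definition curvature :: "(real \<Rightarrow> real^3) \<Rightarrow> real \<Rightarrow> real" where
  "curvature \<gamma> s = norm (vd (vd \<gamma>) s)"

definition normal :: "(real \<Rightarrow> real^3) \<Rightarrow> real \<Rightarrow> real^3" where
  "normal \<gamma> s = (1 / curvature \<gamma> s) *\<^sub>R vd (vd \<gamma>) s"

definition binormal :: "(real \<Rightarrow> real^3) \<Rightarrow> real \<Rightarrow> real^3" where
  "binormal \<gamma> s = tangent \<gamma> s \<times> normal \<gamma> s"

(* The coefficient of B in N' = - \<kappa> T + \<tau> B. *)
definition torsion :: "(real \<Rightarrow> real^3) \<Rightarrow> real \<Rightarrow> real" where
  "torsion \<gamma> s = vd (normal \<gamma>) s \<bullet> binormal \<gamma> s"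

definition frenet_curve :: "real set \<Rightarrow> (real \<Rightarrow> real^3) \<Rightarrow> bool" where
  "frenet_curve I \<gamma> \<longleftrightarrow>
     smooth_on I \<gamma> \<and> (\<forall>s\<in>I. norm (vd \<gamma> s) = 1) \<and> (\<forall>s\<in>I. curvature \<gamma> s \<noteq> 0)"

definition frame_field ::
    "(real \<Rightarrow> real^3) \<Rightarrow> (real \<Rightarrow> real) \<Rightarrow> (real \<Rightarrow> real) \<Rightarrow> (real \<Rightarrow> real) \<Rightarrow> real \<Rightarrow> real^3" where
  "frame_field \<alpha> a b c s = a s *\<^sub>R tangent \<alpha> s + b s *\<^sub>R normal \<alpha> s + c s *\<^sub>R binormal \<alpha> s"

definition direction_curve ::
    "real set \<Rightarrow> (real \<Rightarrow> real^3) \<Rightarrow> (real \<Rightarrow> real^3) \<Rightarrow> bool" where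
  "direction_curve I X \<beta> \<longleftrightarrow> (\<forall>s\<in>I. (\<beta> has_vector_derivative X s) (at s))"

(* A Frenet apparatus of a unit speed curve with either choice of the direction of the
   principal normal: \<kappa> is nonzero but may be negative.  The apparatus with \<kappa> > 0 is
   (tangent, normal, binormal, curvature, torsion); the other one is obtained from it by
   changing the signs of N, B and \<kappa> (see frenet_apparatus_normal). *)
definition frenet_apparatus ::
    "real set \<Rightarrow> (real \<Rightarrow> real^3) \<Rightarrow> (real \<Rightarrow> real^3) \<Rightarrow> (real \<Rightarrow> real^3) \<Rightarrow> (real \<Rightarrow> real^3) \<Rightarrow>
     (real \<Rightarrow> real) \<Rightarrow> (real \<Rightarrow> real) \<Rightarrow> bool" where
  "frenet_apparatus I \<gamma> T N B \<kappa> \<tau> \<longleftrightarrow> (\<forall>s\<in>I.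
     (\<gamma> has_vector_derivative T s) (at s) \<and>
     norm (T s) = 1 \<and> norm (N s) = 1 \<and> T s \<bullet> N s = 0 \<and> B s = T s \<times> N s \<and>
     \<kappa> s \<noteq> 0 \<and>
     (T has_vector_derivative \<kappa> s *\<^sub>R N s) (at s) \<and>
     (N has_vector_derivative - \<kappa> s *\<^sub>R T s + \<tau> s *\<^sub>R B s) (at s) \<and>
     (B has_vector_derivative - \<tau> s *\<^sub>R N s) (at s))"

(* The direction of the principal normal of \<beta> is left free.  For \<beta>' = b N + c B one gets
   \<beta>'' = - b \<kappa> T as soon as b' = c \<tau> and c' = - b \<tau>, so with \<kappa> > 0 imposed on \<beta> the
   condition that its principal normal is T would also force b < 0, which the
   characterisation by b = sin (\<integral>\<tau>), c = cos (\<integral>\<tau>) does not contain. *)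
definition evolute_of :: "real set \<Rightarrow> (real \<Rightarrow> real^3) \<Rightarrow> (real \<Rightarrow> real^3) \<Rightarrow> bool" where
  "evolute_of I \<alpha> \<beta> \<longleftrightarrow> (\<exists>T' N' B' \<kappa>' \<tau>'. frenet_apparatus I \<beta> T' N' B' \<kappa>' \<tau>' \<and>
     (\<forall>s\<in>I. T' s \<bullet> tangent \<alpha> s = 0 \<and> N' s = tangent \<alpha> s))"

definition evolute_direction_curve ::
    "real set \<Rightarrow> (real \<Rightarrow> real^3) \<Rightarrow> (real \<Rightarrow> real^3) \<Rightarrow> (real \<Rightarrow> real^3) \<Rightarrow> bool" where
  "evolute_direction_curve I \<alpha> X \<beta> \<longleftrightarrow> direction_curve I X \<beta> \<and> evolute_of I \<alpha> \<beta>"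

lemma frenet_apparatus_normal:
  assumes I: "open I" "s \<in> I" and F: "frenet_apparatus I \<gamma> T N B \<kappa> \<tau>"
  shows "T s = tangent \<gamma> s" "\<bar>\<kappa> s\<bar> = curvature \<gamma> s"
    "N s = sgn (\<kappa> s) *\<^sub>R normal \<gamma> s" "B s = sgn (\<kappa> s) *\<^sub>R binormal \<gamma> s"
proof -
  have T: "vd \<gamma> t = T t" if "t \<in> I" for t
    using F that unfolding frenet_apparatus_def vd_def
    by (blast intro: vector_derivative_at)
  then show t: "T s = tangent \<gamma> s"
    using I by (simp add: tangent_def)
  have "(T has_vector_derivative \<kappa> s *\<^sub>R N s) (at s)"
    using F I by (auto simp: frenet_apparatus_def)
  then have "(vd \<gamma> has_vector_derivative \<kappa> s *\<^sub>R N s) (at s)"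
    by (rule has_vector_derivative_transform_within_open[OF _ I]) (simp add: T)
  then have d: "vd (vd \<gamma>) s = \<kappa> s *\<^sub>R N s"
    by (simp add: vd_def vector_derivative_at)
  have n: "norm (N s) = 1" "\<kappa> s \<noteq> 0" "B s = T s \<times> N s"
    using F I by (auto simp: frenet_apparatus_def)
  show "\<bar>\<kappa> s\<bar> = curvature \<gamma> s"
    using d n by (simp add: curvature_def)
  then have "normal \<gamma> s = (\<kappa> s / \<bar>\<kappa> s\<bar>) *\<^sub>R N s"
    by (simp add: normal_def d)
  then show N: "N s = sgn (\<kappa> s) *\<^sub>R normal \<gamma> s"
    using n by (simp add: sgn_real_def abs_real_def)
  show "B s = sgn (\<kappa> s) *\<^sub>R binormal \<gamma> s"
    using n t N by (simp add: binormal_def cross_mult_right)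
qed

end

theory Submission
  imports Defs
begin

text \<open>
  Write \<open>X = a T + b N + c B\<close>. The evolute condition \<open>\<langle>X, T\<rangle> = 0\<close> says exactly that \<open>a = 0\<close>, and the
  Frenet equations of \<open>\<alpha>\<close> then give
  \<open>X' = - b \<kappa> T + (b' - c \<tau>) N + (c' + b \<tau>) B\<close> (lemma \<open>has_vector_derivative_normal_plane\<close>).
  Hence \<open>T\<close> is a principal normal direction of \<open>\<beta>\<close> only if \<open>b' = c \<tau>\<close> and \<open>c' = - b \<tau>\<close>: the unit vector
  \<open>(b, c)\<close> rotates with angular velocity \<open>\<tau>\<close>, so it is \<open>(sin \<theta>, cos \<theta>)\<close> for the
  antiderivative \<open>\<theta>\<close> of \<open>\<tau>\<close> with the right initial value
  (lemma \<open>rotating_unit_vector_eq_sin_cos\<close>). Such an antiderivative exists since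
  \<open>\<tau> = b' c - c' b\<close> is continuous.

  Conversely, for \<open>X = sin \<theta> N + cos \<theta> B\<close> with \<open>\<theta>' = \<tau>\<close> the same formula leaves
  \<open>X' = - sin \<theta> \<kappa> T\<close>, and this does not vanish because \<open>\<beta>\<close> is a Frenet curve. So
  \<open>(X, T, X \<times> T)\<close>, with signed curvature \<open>- sin \<theta> \<kappa>\<close> and torsion \<open>cos \<theta> \<kappa>\<close>, is a Frenet
  apparatus of \<open>\<beta>\<close> with principal normal \<open>T\<close> (lemma \<open>rotating_imp_evolute_of\<close>).
\<close>

section \<open>Moving orthonormal frames in Euclidean 3-space\<close>

lemma bounded_bilinear_cross3: "bounded_bilinear (\<lambda>x y :: real^3. x \<times> y)"
  using bilinear_cross bilinear_conv_bounded_bilinear by blast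

lemmas has_vector_derivative_cross3 =
  bounded_bilinear.has_vector_derivative[OF bounded_bilinear_cross3]

lemmas has_vector_derivative_inner =
  bounded_bilinear.has_vector_derivative[OF bounded_bilinear_inner]

text \<open>This turns each orthonormality relation of a frame into a linear relation for the
  derivatives of its vectors.\<close>

lemma inner_derivative_eq_0:
  fixes f g :: "real \<Rightarrow> 'a::real_inner"
  assumes I: "open I" "s \<in> I"
    and f: "(f has_vector_derivative f') (at s)" and g: "(g has_vector_derivative g') (at s)"
    and const: "\<And>t. t \<in> I \<Longrightarrow> f t \<bullet> g t = k"
  shows "f s \<bullet> g' + f' \<bullet> g s = 0"
proof -
  have "((\<lambda>t. f t \<bullet> g t) has_vector_derivative f s \<bullet> g' + f' \<bullet> g s) (at s)"
    by (rule has_vector_derivative_inner[OF f g])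
  moreover have "((\<lambda>t. f t \<bullet> g t) has_vector_derivative 0) (at s)"
    by (rule has_vector_derivative_transform_within_open[OF has_vector_derivative_const[of k] I])
      (simp add: const)
  ultimately show ?thesis
    by (rule vector_derivative_unique_at)
qed

lemma orthonormal_cross3:
  fixes T N B :: "real^3"
  assumes "norm T = 1" "norm N = 1" "T \<bullet> N = 0" "B = T \<times> N"
  shows "norm B = 1" "T \<bullet> B = 0" "N \<bullet> B = 0" "T \<times> B = - N" "B \<times> T = N" "N \<times> T = - B"
proof -
  have TT: "T \<bullet> T = 1"
    using assms by (simp add: norm_eq_1)
  have "(norm B)\<^sup>2 = 1"
    using norm_cross_dot[of T N] assms by simp
  then show "norm B = 1"
    by (simp add: power2_eq_1_iff) (metis norm_ge_zero neg_0_le_iff_le not_one_le_zero)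
  show "T \<bullet> B = 0" "N \<bullet> B = 0"
    by (simp_all add: assms dot_cross_self)
  show "T \<times> B = - N"
    using TT assms by (simp add: Lagrange)
  then show "B \<times> T = N"
    by (metis cross_skew minus_minus)
  show "N \<times> T = - B"
    using assms cross_skew by blast
qed

text \<open>The difference \<open>w\<close> of the two sides is orthogonal to \<open>T\<close> and \<open>N\<close>, hence parallel to
  \<open>T \<times> N\<close>; being orthogonal to that vector as well, it vanishes.\<close>

lemma orthonormal_expansion:
  fixes T N B v :: "real^3"
  assumes "norm T = 1" "norm N = 1" "T \<bullet> N = 0" "B = T \<times> N"
  shows "v = (v \<bullet> T) *\<^sub>R T + (v \<bullet> N) *\<^sub>R N + (v \<bullet> B) *\<^sub>R B"
proof -
  note o = orthonormal_cross3[OF assms]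
  have sq: "T \<bullet> T = 1" "N \<bullet> N = 1" "B \<bullet> B = 1"
    using assms o(1) by (simp_all add: norm_eq_1)
  have BT: "N \<bullet> T = 0" "B \<bullet> T = 0" "B \<bullet> N = 0"
    using assms(3) o(2,3) by (simp_all add: inner_commute)
  define w where "w = v - ((v \<bullet> T) *\<^sub>R T + (v \<bullet> N) *\<^sub>R N + (v \<bullet> B) *\<^sub>R B)"
  have w: "w \<bullet> T = 0" "w \<bullet> N = 0" "w \<bullet> B = 0"
    using sq
    by (simp_all add: w_def assms(3) o(2,3) inner_diff_left inner_add_left BT)
  have "w \<times> B = 0"
    using w assms(4) by (simp add: Lagrange)
  with w(3) have "w = 0 \<or> B = 0"
    using norm_and_cross_eq_0[of w B] by simp
  then show ?thesis
    using o(1) by (auto simp: w_def)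
qed

section \<open>The Frenet equations\<close>

lemma smooth_on_has_vector_derivative:
  assumes "smooth_on I f" "s \<in> I"
  shows "((vd ^^ n) f has_vector_derivative (vd ^^ Suc n) f s) (at s)"
  using assms by (simp add: smooth_on_def vd_def flip: vector_derivative_works)

lemma smooth_on_continuous_on:
  assumes "smooth_on I f"
  shows "continuous_on I ((vd ^^ n) f)"
  using smooth_on_has_vector_derivative[OF assms]
  by (meson continuous_at_imp_continuous_on has_vector_derivative_continuous)

lemma smooth_on_has_real_derivative:
  fixes f :: "real \<Rightarrow> real"
  assumes "smooth_on I f" "s \<in> I"
  shows "(f has_real_derivative vd f s) (at s)"
  using smooth_on_has_vector_derivative[OF assms, of 0]
  by (simp add: has_real_derivative_iff_has_vector_derivative)

text \<open>The Frenet equations. That for \<open>T\<close> is the definition of \<open>N\<close>; differentiating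
  \<open>\<langle>T, N\<rangle> = 0\<close> and \<open>\<langle>N, N\<rangle> = 1\<close> gives the \<open>T\<close>- and \<open>N\<close>-components of \<open>N'\<close>, whose
  \<open>B\<close>-component is \<open>\<tau>\<close> by definition; the product rule for \<open>T \<times> N\<close> then gives \<open>B'\<close>.\<close>

lemma frenet_apparatus_frenet_curve:
  assumes I: "open I" and \<gamma>: "frenet_curve I \<gamma>"
  shows "frenet_apparatus I \<gamma> (tangent \<gamma>) (normal \<gamma>) (binormal \<gamma>) (curvature \<gamma>) (torsion \<gamma>)"
  unfolding frenet_apparatus_def
proof
  fix s assume s: "s \<in> I"
  have sm: "smooth_on I \<gamma>" and unit: "\<And>t. t \<in> I \<Longrightarrow> norm (tangent \<gamma> t) = 1"
    and curv: "\<And>t. t \<in> I \<Longrightarrow> curvature \<gamma> t \<noteq> 0"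
    using \<gamma> by (auto simp: frenet_curve_def tangent_def)
  let ?T = "tangent \<gamma>" and ?N = "normal \<gamma>" and ?B = "binormal \<gamma>"
  have acc: "vd (vd \<gamma>) t = curvature \<gamma> t *\<^sub>R ?N t" if "t \<in> I" for t
    using curv[OF that] by (simp add: normal_def)
  have dT: "(?T has_vector_derivative curvature \<gamma> t *\<^sub>R ?N t) (at t)" if "t \<in> I" for t
    using smooth_on_has_vector_derivative[OF sm that, of 1] acc[OF that]
    by (simp add: tangent_def)
  have unitN: "norm (?N t) = 1" if "t \<in> I" for t
    using curv[OF that] by (simp add: normal_def curvature_def)
  have TN: "?T t \<bullet> ?N t = 0" if "t \<in> I" for t
  proof -
    have "?T t \<bullet> (curvature \<gamma> t *\<^sub>R ?N t) + (curvature \<gamma> t *\<^sub>R ?N t) \<bullet> ?T t = 0"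
      using unit by (intro inner_derivative_eq_0[OF I that dT dT]) (auto simp: that norm_eq_1)
    then show ?thesis
      using curv[OF that] by (simp add: inner_commute)
  qed
  have "(\<lambda>t. (1 / norm (vd (vd \<gamma>) t)) *\<^sub>R vd (vd \<gamma>) t) differentiable at s"
  proof -
    have 2: "vd (vd \<gamma>) differentiable at s"
      using sm s by (auto simp: smooth_on_def dest!: spec[of _ 2] simp: numeral_2_eq_2)
    moreover have "vd (vd \<gamma>) s \<noteq> 0"
      using curv[OF s] by (simp add: curvature_def)
    ultimately show ?thesis
      by (intro differentiable_scaleR differentiable_divide differentiable_const
          differentiable_compose[of norm "vd (vd \<gamma>)"] differentiable_norm_at) auto
  qed
  then have dN: "(?N has_vector_derivative vd ?N s) (at s)"
    by (simp add: normal_def[abs_def] curvature_def vd_def flip: vector_derivative_works)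
  have "?T s \<bullet> vd ?N s + (curvature \<gamma> s *\<^sub>R ?N s) \<bullet> ?N s = 0"
    by (rule inner_derivative_eq_0[OF I s dT[OF s] dN TN])
  then have N'T: "vd ?N s \<bullet> ?T s = - curvature \<gamma> s"
    using unitN[OF s] by (simp add: norm_eq_1 inner_commute)
  have "?N s \<bullet> vd ?N s + vd ?N s \<bullet> ?N s = 0"
    using unitN by (intro inner_derivative_eq_0[OF I s dN dN]) (auto simp: norm_eq_1)
  then have N'N: "vd ?N s \<bullet> ?N s = 0"
    by (simp add: inner_commute)
  have B: "?B s = ?T s \<times> ?N s"
    by (simp add: binormal_def)
  have N': "vd ?N s = - curvature \<gamma> s *\<^sub>R ?T s + torsion \<gamma> s *\<^sub>R ?B s"
    using orthonormal_expansion[OF unit[OF s] unitN[OF s] TN[OF s] B, of "vd ?N s"]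
    unfolding N'T N'N by (simp add: torsion_def)
  have "(?B has_vector_derivative ?T s \<times> vd ?N s + (curvature \<gamma> s *\<^sub>R ?N s) \<times> ?N s) (at s)"
    unfolding binormal_def[abs_def] by (rule has_vector_derivative_cross3[OF dT[OF s] dN])
  also have "?T s \<times> vd ?N s + (curvature \<gamma> s *\<^sub>R ?N s) \<times> ?N s = - torsion \<gamma> s *\<^sub>R ?N s"
    by (simp add: N' Cross3.right_diff_distrib cross_mult_right cross_mult_left
        orthonormal_cross3(4)[OF unit[OF s] unitN[OF s] TN[OF s] B])
  finally have dB: "(?B has_vector_derivative - torsion \<gamma> s *\<^sub>R ?N s) (at s)" .
  have "(\<gamma> has_vector_derivative ?T s) (at s)"
    using smooth_on_has_vector_derivative[OF sm s, of 0] by (simp add: tangent_def)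
  then show "(\<gamma> has_vector_derivative ?T s) (at s) \<and>
     norm (?T s) = 1 \<and> norm (?N s) = 1 \<and> ?T s \<bullet> ?N s = 0 \<and> ?B s = ?T s \<times> ?N s \<and>
     curvature \<gamma> s \<noteq> 0 \<and>
     (?T has_vector_derivative curvature \<gamma> s *\<^sub>R ?N s) (at s) \<and>
     (?N has_vector_derivative - curvature \<gamma> s *\<^sub>R ?T s + torsion \<gamma> s *\<^sub>R ?B s) (at s) \<and>
     (?B has_vector_derivative - torsion \<gamma> s *\<^sub>R ?N s) (at s)"
    using s unit unitN TN B curv dT dN N' dB by simp
qed

text \<open>The central computation: a field in the normal plane moves in the direction of the
  tangent exactly when the last two coefficients vanish.\<close>

lemma has_vector_derivative_normal_plane:
  assumes F: "frenet_apparatus I \<gamma> T N B \<kappa> \<tau>" and s: "s \<in> I"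
    and b: "(b has_real_derivative b') (at s)" and c: "(c has_real_derivative c') (at s)"
  shows "((\<lambda>t. b t *\<^sub>R N t + c t *\<^sub>R B t) has_vector_derivative
     - (b s * \<kappa> s) *\<^sub>R T s + (b' - c s * \<tau> s) *\<^sub>R N s + (c' + b s * \<tau> s) *\<^sub>R B s) (at s)"
proof -
  have dN: "(N has_vector_derivative - \<kappa> s *\<^sub>R T s + \<tau> s *\<^sub>R B s) (at s)"
    and dB: "(B has_vector_derivative - \<tau> s *\<^sub>R N s) (at s)"
    using F s by (auto simp: frenet_apparatus_def)
  show ?thesis
    by (rule has_vector_derivative_eq_rhs[OF has_vector_derivative_add[OF
          has_vector_derivative_scaleR[OF b dN] has_vector_derivative_scaleR[OF c dB]]])
      (simp add: algebra_simps)
qed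

section \<open>Rotating unit vectors in the plane\<close>

text \<open>The interval may be unbounded and \<open>f\<close> need not be integrable over it, so the integral is
  taken from a fixed point \<open>p\<close> of the interval. To differentiate it at \<open>s\<close>, a compact
  subinterval with \<open>p\<close> and \<open>s\<close> in its interior suffices.\<close>

lemma antiderivative_on_open_interval:
  fixes f :: "real \<Rightarrow> real"
  assumes I: "open I" "is_interval I" and f: "continuous_on I f"
  shows "\<exists>F. \<forall>s\<in>I. (F has_real_derivative f s) (at s)"
proof (cases "I = {}")
  case False
  then obtain p where p: "p \<in> I" by blast
  have "((\<lambda>u. LBINT y=p..u. f y) has_real_derivative f s) (at s)" if s: "s \<in> I" for s
  proof -
    have I': "min p s \<in> I" "max p s \<in> I"
      using p s by (simp_all add: min_def max_def)
    have less: "min p s - 1 < min p s" "max p s < max p s + 1"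
      by linarith+
    obtain d\<^sub>0 where d\<^sub>0: "d\<^sub>0 < min p s" "{d\<^sub>0<..min p s} \<subseteq> I"
      using open_left[OF I(1) I'(1) less(1)] by blast
    obtain e\<^sub>0 where e\<^sub>0: "max p s < e\<^sub>0" "{max p s..<e\<^sub>0} \<subseteq> I"
      using open_right[OF I(1) I'(2) less(2)] by blast
    obtain d e where "d\<^sub>0 < d" "d < min p s" "max p s < e" "e < e\<^sub>0"
      using dense[OF d\<^sub>0(1)] dense[OF e\<^sub>0(1)] by blast
    then have de: "d < min p s" "d \<in> I" "max p s < e" "e \<in> I"
      using subsetD[OF d\<^sub>0(2), of d] subsetD[OF e\<^sub>0(2), of e] by simp_all
    then have "{d..e} \<subseteq> I"
      using mem_is_interval_1_I[OF I(2)] by (meson atLeastAtMost_iff subsetI)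
    then have "((\<lambda>u. LBINT y=p..u. f y) has_vector_derivative f s) (at s within {d..e})"
      using de f by (intro interval_integral_FTC2) (auto intro: continuous_on_subset)
    moreover have "at s within {d..e} = at s"
      using de by (intro at_within_interior) simp
    ultimately show ?thesis
      by (simp add: has_real_derivative_iff_has_vector_derivative)
  qed
  then show ?thesis by blast
qed auto

text \<open>Choose an antiderivative \<open>\<theta>\<close> of \<open>\<omega>\<close> for which \<open>(b, c) = (sin \<theta>, cos \<theta>)\<close> at one point.
  Both sides rotate with angular velocity \<open>\<omega>\<close>, so their inner product is constant and equals 1;
  unit vectors with inner product 1 coincide.\<close>

lemma rotating_unit_vector_eq_sin_cos:
  fixes b c \<omega> :: "real \<Rightarrow> real"
  assumes I: "open I" "is_interval I" and \<omega>: "continuous_on I \<omega>"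
    and db: "\<And>s. s \<in> I \<Longrightarrow> (b has_real_derivative c s * \<omega> s) (at s)"
    and dc: "\<And>s. s \<in> I \<Longrightarrow> (c has_real_derivative - (b s * \<omega> s)) (at s)"
    and unit: "\<And>s. s \<in> I \<Longrightarrow> (b s)\<^sup>2 + (c s)\<^sup>2 = 1"
  obtains \<theta> where "\<And>s. s \<in> I \<Longrightarrow> (\<theta> has_real_derivative \<omega> s) (at s)"
    "\<And>s. s \<in> I \<Longrightarrow> b s = sin (\<theta> s)" "\<And>s. s \<in> I \<Longrightarrow> c s = cos (\<theta> s)"
proof (cases "I = {}")
  case True
  then show ?thesis using that by blast
next
  case False
  then obtain p where p: "p \<in> I" by blast
  obtain F where F: "\<And>s. s \<in> I \<Longrightarrow> (F has_real_derivative \<omega> s) (at s)"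
    using antiderivative_on_open_interval[OF I \<omega>] by blast
  obtain t where t: "c p = cos t" "b p = sin t"
    using sincos_total_2pi[of "c p" "b p"] unit[OF p] by (auto simp: add.commute)
  define \<theta> where "\<theta> = (\<lambda>s. F s - F p + t)"
  have d\<theta>: "(\<theta> has_real_derivative \<omega> s) (at s)" if "s \<in> I" for s
    unfolding \<theta>_def using F[OF that] by (auto intro!: derivative_eq_intros)
  let ?g = "\<lambda>s. b s * sin (\<theta> s) + c s * cos (\<theta> s)"
  have "(?g has_real_derivative 0) (at s within I)" if s: "s \<in> I" for s
  proof -
    have "(?g has_real_derivative 0) (at s)"
      using db[OF s] dc[OF s] d\<theta>[OF s]
      by (auto intro!: derivative_eq_intros simp: algebra_simps)
    then show ?thesis
      by (rule has_field_derivative_at_within)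
  qed
  moreover have "convex I"
    using I(2) by (rule is_interval_convex)
  ultimately obtain k where k: "\<And>s. s \<in> I \<Longrightarrow> ?g s = k"
    using has_field_derivative_zero_constant[of I ?g] by blast
  have "k = 1"
    using k[OF p] t sin_cos_squared_add[of t] by (simp add: \<theta>_def power2_eq_square)
  have "b s = sin (\<theta> s) \<and> c s = cos (\<theta> s)" if s: "s \<in> I" for s
  proof -
    have "(b s - sin (\<theta> s))\<^sup>2 + (c s - cos (\<theta> s))\<^sup>2
        = ((b s)\<^sup>2 + (c s)\<^sup>2) + ((sin (\<theta> s))\<^sup>2 + (cos (\<theta> s))\<^sup>2) - 2 * ?g s"
      by (simp add: power2_eq_square algebra_simps)
    also have "\<dots> = 0"
      using unit[OF s] k[OF s] \<open>k = 1\<close> by simp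
    finally show ?thesis
      by (simp add: sum_power2_eq_zero_iff)
  qed
  then show ?thesis
    using that d\<theta> by blast
qed

section \<open>Evolute-direction curves\<close>

text \<open>Any Frenet apparatus of \<open>\<beta>\<close> has \<open>X\<close> as its tangent field, so \<open>X'\<close> is a multiple of its
  principal normal \<open>T\<close>; the claims are the vanishing of the \<open>T\<close>-component of \<open>X\<close> and of the
  \<open>N\<close>- and \<open>B\<close>-components of \<open>X'\<close>.\<close>

lemma evolute_direction_imp_rotating:
  assumes I: "open I" and \<alpha>: "frenet_curve I \<alpha>"
    and sm: "smooth_on I b" "smooth_on I c"
    and ev: "evolute_direction_curve I \<alpha> (frame_field \<alpha> a b c) \<beta>"
    and s: "s \<in> I"
  shows "a s = 0" "vd b s = c s * torsion \<alpha> s" "vd c s = - (b s * torsion \<alpha> s)"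
proof -
  let ?T = "tangent \<alpha>" and ?N = "normal \<alpha>" and ?B = "binormal \<alpha>"
  note F = frenet_apparatus_frenet_curve[OF I \<alpha>]
  have fr: "norm (?T t) = 1" "norm (?N t) = 1" "?T t \<bullet> ?N t = 0" "?B t = ?T t \<times> ?N t"
    if "t \<in> I" for t
    using F that by (auto simp: frenet_apparatus_def)
  have o: "norm (?B t) = 1" "?T t \<bullet> ?B t = 0" "?N t \<bullet> ?B t = 0" if "t \<in> I" for t
    using orthonormal_cross3[OF fr] that by blast+
  have o': "?N t \<bullet> ?T t = 0" "?B t \<bullet> ?T t = 0" "?B t \<bullet> ?N t = 0" if "t \<in> I" for t
    using fr(3)[OF that] o(2,3)[OF that] by (simp_all add: inner_commute)
  obtain T' N' B' \<kappa>' \<tau>' where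
    F': "frenet_apparatus I \<beta> T' N' B' \<kappa>' \<tau>'" and
    ortho: "\<And>t. t \<in> I \<Longrightarrow> T' t \<bullet> ?T t = 0" and par: "\<And>t. t \<in> I \<Longrightarrow> N' t = ?T t"
    using ev by (auto simp: evolute_direction_curve_def evolute_of_def)
  have T': "T' t = frame_field \<alpha> a b c t" if "t \<in> I" for t
    using F' ev that
    by (auto simp: frenet_apparatus_def evolute_direction_curve_def direction_curve_def
        intro: vector_derivative_unique_at)
  have a0: "a t = 0" if "t \<in> I" for t
    using ortho[OF that] T'[OF that] fr(1)[OF that] o'(1,2)[OF that]
    by (auto simp: frame_field_def inner_add_left norm_eq_1)
  then show "a s = 0"
    using s .
  have "(T' has_vector_derivative \<kappa>' s *\<^sub>R ?T s) (at s)"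
    using F' s par[OF s] by (auto simp: frenet_apparatus_def)
  then have "((\<lambda>t. b t *\<^sub>R ?N t + c t *\<^sub>R ?B t) has_vector_derivative \<kappa>' s *\<^sub>R ?T s) (at s)"
    by (rule has_vector_derivative_transform_within_open[OF _ I s])
      (simp add: T' a0 frame_field_def)
  then have eq: "\<kappa>' s *\<^sub>R ?T s = - (b s * curvature \<alpha> s) *\<^sub>R ?T s
      + (vd b s - c s * torsion \<alpha> s) *\<^sub>R ?N s + (vd c s + b s * torsion \<alpha> s) *\<^sub>R ?B s"
    using has_vector_derivative_normal_plane[OF F s
        smooth_on_has_real_derivative[OF sm(1) s] smooth_on_has_real_derivative[OF sm(2) s]]
    by (rule vector_derivative_unique_at)
  show "vd b s = c s * torsion \<alpha> s"
    using arg_cong[OF eq, of "\<lambda>v. v \<bullet> ?N s"] fr(2,3)[OF s] o'(3)[OF s]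
    by (auto simp: inner_add_left inner_diff_left norm_eq_1)
  show "vd c s = - (b s * torsion \<alpha> s)"
    using arg_cong[OF eq, of "\<lambda>v. v \<bullet> ?B s"] o[OF s]
    by (auto simp: inner_add_left inner_diff_left norm_eq_1)
qed

text \<open>Here \<open>X = sin \<theta> N + cos \<theta> B\<close> and \<open>Y = X \<times> T = cos \<theta> N - sin \<theta> B\<close> both rotate with
  angular velocity \<open>\<tau>\<close> in the normal plane of \<open>\<alpha>\<close>, so their derivatives are multiples of \<open>T\<close>;
  resolving \<open>T' = \<kappa> N\<close> along \<open>X\<close> and \<open>Y\<close> gives the third Frenet equation. Since \<open>\<beta>\<close> is
  assumed to be a Frenet curve, \<open>sin \<theta>\<close> cannot vanish.\<close>

lemma rotating_imp_evolute_of: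
  assumes I: "open I" and \<alpha>: "frenet_curve I \<alpha>" and \<beta>: "frenet_curve I \<beta>"
    and d\<theta>: "\<And>s. s \<in> I \<Longrightarrow> (\<theta> has_real_derivative torsion \<alpha> s) (at s)"
    and d\<beta>: "\<And>s. s \<in> I \<Longrightarrow> (\<beta> has_vector_derivative
      sin (\<theta> s) *\<^sub>R normal \<alpha> s + cos (\<theta> s) *\<^sub>R binormal \<alpha> s) (at s)"
  shows "evolute_of I \<alpha> \<beta>"
proof -
  let ?T = "tangent \<alpha>" and ?N = "normal \<alpha>" and ?B = "binormal \<alpha>"
  let ?\<kappa> = "curvature \<alpha>" and ?\<tau> = "torsion \<alpha>"
  note F = frenet_apparatus_frenet_curve[OF I \<alpha>]
  let ?X = "\<lambda>s. sin (\<theta> s) *\<^sub>R ?N s + cos (\<theta> s) *\<^sub>R ?B s"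
  let ?Y = "\<lambda>s. cos (\<theta> s) *\<^sub>R ?N s + (- sin (\<theta> s)) *\<^sub>R ?B s"
  have "frenet_apparatus I \<beta> ?X ?T ?Y (\<lambda>s. - (sin (\<theta> s) * ?\<kappa> s)) (\<lambda>s. cos (\<theta> s) * ?\<kappa> s)"
    unfolding frenet_apparatus_def
  proof
    fix s assume s: "s \<in> I"
    have fr: "norm (?T s) = 1" "norm (?N s) = 1" "?T s \<bullet> ?N s = 0" "?B s = ?T s \<times> ?N s"
      and dT: "(?T has_vector_derivative ?\<kappa> s *\<^sub>R ?N s) (at s)"
      using F s by (auto simp: frenet_apparatus_def)
    note o = orthonormal_cross3[OF fr]
    have o': "?N s \<bullet> ?T s = 0" "?B s \<bullet> ?T s = 0" "?B s \<bullet> ?N s = 0"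
      using fr(3) o(2,3) by (simp_all add: inner_commute)
    have ds: "((\<lambda>t. sin (\<theta> t)) has_real_derivative cos (\<theta> t) * ?\<tau> t) (at t)"
      and dc: "((\<lambda>t. cos (\<theta> t)) has_real_derivative - sin (\<theta> t) * ?\<tau> t) (at t)"
      and dms: "((\<lambda>t. - sin (\<theta> t)) has_real_derivative - cos (\<theta> t) * ?\<tau> t) (at t)"
      if "t \<in> I" for t
      using d\<theta>[OF that] by (auto intro!: derivative_eq_intros)
    have dX: "(?X has_vector_derivative - (sin (\<theta> s) * ?\<kappa> s) *\<^sub>R ?T s) (at s)"
      using has_vector_derivative_normal_plane[OF F s ds[OF s] dc[OF s]] by simp
    have dY: "(?Y has_vector_derivative - (cos (\<theta> s) * ?\<kappa> s) *\<^sub>R ?T s) (at s)"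
      using has_vector_derivative_normal_plane[OF F s dc[OF s] dms[OF s]] by simp
    have sc: "sin (\<theta> s) * sin (\<theta> s) + cos (\<theta> s) * cos (\<theta> s) = 1"
      using sin_cos_squared_add[of "\<theta> s"] by (simp add: power2_eq_square)
    have X1: "norm (?X s) = 1"
      using fr(2) o(1,3) o'(3) sc by (simp add: norm_eq_1 inner_add_left inner_add_right)
    have XT: "?X s \<bullet> ?T s = 0"
      using o' by (simp add: inner_add_left)
    have Y: "?Y s = ?X s \<times> ?T s"
      by (simp add: cross_add_left cross_mult_left o(5,6))
    have "(vd \<beta> has_vector_derivative - (sin (\<theta> s) * ?\<kappa> s) *\<^sub>R ?T s) (at s)"
      by (rule has_vector_derivative_transform_within_open[OF dX I s])
        (simp add: vd_def vector_derivative_at[OF d\<beta>])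
    then have "vd (vd \<beta>) s = - (sin (\<theta> s) * ?\<kappa> s) *\<^sub>R ?T s"
      unfolding vd_def[of "vd \<beta>"] by (rule vector_derivative_at)
    then have nz: "- (sin (\<theta> s) * ?\<kappa> s) \<noteq> 0"
      using \<beta> s by (auto simp: frenet_curve_def curvature_def)
    have N: "?\<kappa> s *\<^sub>R ?N s = - (- (sin (\<theta> s) * ?\<kappa> s)) *\<^sub>R ?X s + (cos (\<theta> s) * ?\<kappa> s) *\<^sub>R ?Y s"
    proof -
      have "- (- (sin (\<theta> s) * ?\<kappa> s)) *\<^sub>R ?X s + (cos (\<theta> s) * ?\<kappa> s) *\<^sub>R ?Y s
          = (?\<kappa> s * (sin (\<theta> s) * sin (\<theta> s))) *\<^sub>R ?N s + (?\<kappa> s * (cos (\<theta> s) * cos (\<theta> s))) *\<^sub>R ?N s"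
        by (simp add: algebra_simps)
      also have "\<dots> = ?\<kappa> s *\<^sub>R ?N s"
        by (simp only: sc mult_1_right flip: scaleR_add_left distrib_left)
      finally show ?thesis by (rule sym)
    qed
    have dT': "(?T has_vector_derivative
         - (- (sin (\<theta> s) * ?\<kappa> s)) *\<^sub>R ?X s + (cos (\<theta> s) * ?\<kappa> s) *\<^sub>R ?Y s) (at s)"
      by (rule has_vector_derivative_eq_rhs[OF dT N])
    show "(\<beta> has_vector_derivative ?X s) (at s) \<and>
      norm (?X s) = 1 \<and> norm (?T s) = 1 \<and> ?X s \<bullet> ?T s = 0 \<and> ?Y s = ?X s \<times> ?T s \<and>
      - (sin (\<theta> s) * ?\<kappa> s) \<noteq> 0 \<and>
      (?X has_vector_derivative - (sin (\<theta> s) * ?\<kappa> s) *\<^sub>R ?T s) (at s) \<and>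
      (?T has_vector_derivative
         - (- (sin (\<theta> s) * ?\<kappa> s)) *\<^sub>R ?X s + (cos (\<theta> s) * ?\<kappa> s) *\<^sub>R ?Y s) (at s) \<and>
      (?Y has_vector_derivative - (cos (\<theta> s) * ?\<kappa> s) *\<^sub>R ?T s) (at s)"
      by (intro conjI d\<beta>[OF s] X1 fr(1) XT Y nz dX dT' dY)
  qed
  moreover have "\<forall>s\<in>I. ?X s \<bullet> ?T s = 0 \<and> ?T s = tangent \<alpha> s"
    using calculation by (simp add: frenet_apparatus_def)
  ultimately show ?thesis
    unfolding evolute_of_def by blast
qed

theorem proposition3p2:
  fixes I :: "real set" and \<alpha> \<beta> :: "real \<Rightarrow> real^3" and a b c :: "real \<Rightarrow> real"
  assumes "open I" and "is_interval I"
    and "frenet_curve I \<alpha>"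
    and "smooth_on I a" and "smooth_on I b" and "smooth_on I c"
    and "\<And>s. s \<in> I \<Longrightarrow> (a s)\<^sup>2 + (b s)\<^sup>2 + (c s)\<^sup>2 = 1"
    and "direction_curve I (frame_field \<alpha> a b c) \<beta>"
    and "frenet_curve I \<beta>"
  shows "evolute_direction_curve I \<alpha> (frame_field \<alpha> a b c) \<beta> \<longleftrightarrow>
    (\<exists>\<theta>. (\<forall>s\<in>I. (\<theta> has_real_derivative torsion \<alpha> s) (at s)) \<and>
         (\<forall>s\<in>I. a s = 0 \<and> b s = sin (\<theta> s) \<and> c s = cos (\<theta> s)))"
proof
  assume ev: "evolute_direction_curve I \<alpha> (frame_field \<alpha> a b c) \<beta>"
  note rot = evolute_direction_imp_rotating[OF assms(1,3,5,6) ev]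
  have bc: "(b s)\<^sup>2 + (c s)\<^sup>2 = 1" if "s \<in> I" for s
    using assms(7)[OF that] rot(1)[OF that] by simp
  \<comment> \<open>Solving the rotation equations for the torsion shows that it is continuous.\<close>
  have "continuous_on I (\<lambda>s. vd b s * c s - vd c s * b s)"
    using smooth_on_continuous_on[OF assms(5), of 0] smooth_on_continuous_on[OF assms(5), of 1]
      smooth_on_continuous_on[OF assms(6), of 0] smooth_on_continuous_on[OF assms(6), of 1]
    by (auto intro!: continuous_intros)
  moreover have "vd b s * c s - vd c s * b s = torsion \<alpha> s" if s: "s \<in> I" for s
  proof -
    have "vd b s * c s - vd c s * b s = torsion \<alpha> s * ((b s)\<^sup>2 + (c s)\<^sup>2)"
      by (simp add: rot(2,3)[OF s] power2_eq_square algebra_simps)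
    then show ?thesis by (simp add: bc[OF s])
  qed
  ultimately have cont: "continuous_on I (torsion \<alpha>)"
    by (simp cong: continuous_on_cong)
  have db: "(b has_real_derivative c s * torsion \<alpha> s) (at s)"
    and dc: "(c has_real_derivative - (b s * torsion \<alpha> s)) (at s)" if "s \<in> I" for s
    using smooth_on_has_real_derivative[OF assms(5) that]
      smooth_on_has_real_derivative[OF assms(6) that] rot(2,3)[OF that] by simp_all
  obtain \<theta> where "\<And>s. s \<in> I \<Longrightarrow> (\<theta> has_real_derivative torsion \<alpha> s) (at s)"
    "\<And>s. s \<in> I \<Longrightarrow> b s = sin (\<theta> s)" "\<And>s. s \<in> I \<Longrightarrow> c s = cos (\<theta> s)"
    using rotating_unit_vector_eq_sin_cos[OF assms(1,2) cont db dc bc] by blast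
  with rot(1) show "\<exists>\<theta>. (\<forall>s\<in>I. (\<theta> has_real_derivative torsion \<alpha> s) (at s)) \<and>
         (\<forall>s\<in>I. a s = 0 \<and> b s = sin (\<theta> s) \<and> c s = cos (\<theta> s))"
    by blast
next
  assume "\<exists>\<theta>. (\<forall>s\<in>I. (\<theta> has_real_derivative torsion \<alpha> s) (at s)) \<and>
         (\<forall>s\<in>I. a s = 0 \<and> b s = sin (\<theta> s) \<and> c s = cos (\<theta> s))"
  then obtain \<theta> where
    d\<theta>: "\<And>s. s \<in> I \<Longrightarrow> (\<theta> has_real_derivative torsion \<alpha> s) (at s)" and
    abc: "\<And>s. s \<in> I \<Longrightarrow> a s = 0 \<and> b s = sin (\<theta> s) \<and> c s = cos (\<theta> s)"
    by blast
  have "(\<beta> has_vector_derivative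
      sin (\<theta> s) *\<^sub>R normal \<alpha> s + cos (\<theta> s) *\<^sub>R binormal \<alpha> s) (at s)" if "s \<in> I" for s
    using assms(8) abc[OF that] that by (auto simp: direction_curve_def frame_field_def)
  then have "evolute_of I \<alpha> \<beta>"
    using rotating_imp_evolute_of[OF assms(1,3,9) d\<theta>] by blast
  with assms(8) show "evolute_direction_curve I \<alpha> (frame_field \<alpha> a b c) \<beta>"
    by (simp add: evolute_direction_curve_def)
qed

end
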